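(* Let $K\ge 2$ be an integer and let $g\in\mathcal{C}^K(\mathbb{R},\mathbb{R})$ be such that $u=0$ and $u=1$ are two consecutive zeros of $g$, $g$ is concave on $[0,1]$, and $g'(1)<0<g'(0)$. Let $c>2\sqrt{g'(0)}$. Then there exists $h_0>0$ such that for all $h\in(0,h_0)$ there exists a profile $\phi_h\in\mathcal{C}^{K+1}(\mathbb{R},\mathbb{R})$ with $\lim_{x\to-\infty}\phi_h(x)=1$ and $\lim_{x\to+\infty}\phi_h(x)=0$ such that $u_j(t)=\phi_h(jh-ct)$ solves $$\dot u_j(t)=\frac{u_{j+1}(t)-2u_j(t)+u_{j-1}(t)}{h^2}+g(u_j(t)),\qquad t>0,\ j\in\mathbb{Z}.$$
   Context: "Consecutive zeros" means $g(0)=g(1)=0$ and $g$ does not vanish on $(0,1)$. *)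

theory Defs
  imports "HOL-Analysis.Analysis"
begin

definition C_k :: "nat \<Rightarrow> (real \<Rightarrow> real) \<Rightarrow> bool" where
  "C_k k f \<longleftrightarrow>
     (\<forall>i<k. \<forall>x. (deriv ^^ i) f differentiable (at x)) \<and>
     continuous_on UNIV ((deriv ^^ k) f)"

definition consecutive_zeros :: "(real \<Rightarrow> real) \<Rightarrow> real \<Rightarrow> real \<Rightarrow> bool" where
  "consecutive_zeros g a b \<longleftrightarrow>
     a < b \<and> g a = 0 \<and> g b = 0 \<and> (\<forall>u\<in>{a<..<b}. g u \<noteq> 0)"

definition solves_lattice_rd ::
    "real \<Rightarrow> (real \<Rightarrow> real) \<Rightarrow> (int \<Rightarrow> real \<Rightarrow> real) \<Rightarrow> bool" where
  "solves_lattice_rd h g u \<longleftrightarrow>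
     (\<forall>t>0. \<forall>j.
        (u j has_real_derivative
           (u (j + 1) t - 2 * u j t + u (j - 1) t) / h\<^sup>2 + g (u j t)) (at t))"

end

theory Submission
  imports Defs "HOL-Probability.Distributions" "HOL-Real_Asymp.Real_Asymp"
begin

text \<open>
  Substituting \<open>u j t = \<phi> (j h - c t)\<close> turns the lattice equation into the profile equation
  \<open>- c \<phi>' x = (\<phi> (x + h) - 2 \<phi> x + \<phi> (x - h)) / h\<^sup>2 + g (\<phi> x)\<close>.  Adding a multiple
  \<open>\<mu> \<phi>\<close> on both sides makes the right-hand side \<open>H \<phi>\<close> monotone in \<open>\<phi>\<close>, and inverting
  \<open>\<mu> - c d/dx\<close> on bounded functions yields the equivalent fixed-point equation
  \<open>\<phi> x = E [H \<phi> (x + X)] / \<mu>\<close>, where \<open>X\<close> is an exponential random variable of rate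
  \<open>\<mu> / c\<close>.  Its right-hand side \<open>T\<close> preserves the pointwise order and antitonicity.

  On exponentials, the linearised equation at 0 holds for \<open>exp (- a x)\<close> exactly when
  \<open>c a = dispersion h r a\<close> with \<open>r = g' 0\<close>.  As \<open>h\<close> tends to 0 the dispersion function tends to
  \<open>a\<^sup>2 + r\<close>, and \<open>c > 2 sqrt r\<close> says that \<open>a\<^sup>2 + r < c a\<close> at \<open>a = c / 2\<close>.  So for small \<open>h\<close>
  the strict inequality \<open>dispersion h r a < c a\<close> holds somewhere, and by the intermediate value
  theorem and convexity there is a root \<open>\<alpha>\<close> with the strict inequality just to its right
  (\<open>dispersion_roots\<close>).

  Concavity gives \<open>g u \<le> r u\<close>, hence \<open>min 1 (exp (- \<alpha> x))\<close> is a supersolution (\<open>H_upper\<close>).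
  Two derivatives give \<open>g u \<ge> r u - L u\<^sup>2\<close>, hence \<open>max 0 (exp (- \<alpha> x) - M exp (- \<kappa> x))\<close> is a
  subsolution for \<open>\<kappa>\<close> slightly larger than \<open>\<alpha>\<close> and \<open>M\<close> large: the strict inequality at
  \<open>\<kappa>\<close> pays for the quadratic error (\<open>H_lower\<close>).  Therefore \<open>T\<close> maps the antitone functions
  between these two barriers into themselves, and the argument of Knaster and Tarski provides a
  fixed point (\<open>antimono_fixed_point_between\<close>).

  The upper barrier forces the limit 0 at \<open>+\<infinity>\<close>.  At \<open>-\<infinity>\<close> the antitone profile has a limit
  \<open>a\<close>, positive because of the lower barrier and at most 1; passing to the limit in the fixed-point
  equation gives \<open>g a = 0\<close>, so \<open>a = 1\<close>.  Averaging makes a fixed point continuous, then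
  differentiable, and the profile equation raises its smoothness one order at a time up to one more
  than that of \<open>g\<close>.
\<close>

section \<open>Averages against an exponential distribution\<close>

text \<open>
  For bounded \<open>F\<close> this is the bounded solution of \<open>f - f' / \<nu> = F\<close>: the resolvent of the
  derivative, normalised so that it fixes constants.  The probabilistic form makes monotonicity and
  dominated convergence immediate.
\<close>

definition exp_avg :: "real \<Rightarrow> (real \<Rightarrow> real) \<Rightarrow> real \<Rightarrow> real" where
  "exp_avg \<nu> F x = (LINT s|density lborel (exponential_density \<nu>). F (x + s))"

lemma exp_avg_integrable_bounded:
  fixes \<nu> B :: real
  assumes \<nu>: "\<nu> > 0" and F [measurable]: "F \<in> borel_measurable borel" and B: "\<And>y. \<bar>F y\<bar> \<le> B"
  shows "integrable (density lborel (exponential_density \<nu>)) (\<lambda>s. F (x + s))"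
proof -
  interpret prob_space "density lborel (exponential_density \<nu>)"
    by (rule prob_space_exponential_density[OF \<nu>])
  show ?thesis
    by (rule integrable_const_bound[where B = B]) (auto simp: B)
qed

lemma exp_avg_const:
  assumes "\<nu> > 0"
  shows "exp_avg \<nu> (\<lambda>_. C) x = C"
proof -
  interpret prob_space "density lborel (exponential_density \<nu>)"
    by (rule prob_space_exponential_density[OF assms])
  show ?thesis using prob_space by (simp add: exp_avg_def)
qed

text \<open>
  Decaying exponentials are eigenfunctions of the resolvent; multiplying the density of rate
  \<open>\<nu>\<close> by \<open>exp (- a s)\<close> gives a multiple of the density of rate \<open>\<nu> + a\<close>.
\<close>

lemma exp_avg_exponential:
  assumes \<nu>: "\<nu> > 0" and a: "a > 0"
  shows "integrable (density lborel (exponential_density \<nu>)) (\<lambda>s. exp (- a * (x + s)))"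
    and "exp_avg \<nu> (\<lambda>y. exp (- a * y)) x = \<nu> / (\<nu> + a) * exp (- a * x)"
proof -
  have pos: "\<nu> + a > 0" using assms by simp
  interpret P: prob_space "density lborel (exponential_density (\<nu> + a))"
    by (rule prob_space_exponential_density[OF pos])
  have "integrable (density lborel (exponential_density (\<nu> + a))) (\<lambda>_. 1 :: real)"
    by simp
  then have int1: "integrable lborel (exponential_density (\<nu> + a))"
    using pos by (subst (asm) integrable_density) auto
  have "(LINT _|density lborel (exponential_density (\<nu> + a)). (1 :: real)) = 1"
    using P.prob_space by simp
  then have val1: "(LINT s|lborel. exponential_density (\<nu> + a) s) = 1"
    using pos by (subst (asm) integral_density) auto
  have eq: "exponential_density \<nu> s *\<^sub>R exp (- a * (x + s))
      = (\<nu> / (\<nu> + a) * exp (- a * x)) * exponential_density (\<nu> + a) s" for s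
    using pos by (simp add: exponential_density_def exp_add[symmetric] field_simps mult_exp_exp)
  show "integrable (density lborel (exponential_density \<nu>)) (\<lambda>s. exp (- a * (x + s)))"
    using \<nu> int1 by (subst integrable_density) (auto simp only: eq intro!: integrable_mult_right AE_I2 | simp)+
  show "exp_avg \<nu> (\<lambda>y. exp (- a * y)) x = \<nu> / (\<nu> + a) * exp (- a * x)"
    unfolding exp_avg_def using \<nu> 
    by (subst integral_density) (simp_all only: eq integral_mult_right_zero val1 | simp)+
qed

lemma exp_avg_mono:
  assumes "integrable (density lborel (exponential_density \<nu>)) (\<lambda>s. F (x + s))"
    and "integrable (density lborel (exponential_density \<nu>)) (\<lambda>s. G (x + s))"
    and "\<And>y. F y \<le> G y"
  shows "exp_avg \<nu> F x \<le> exp_avg \<nu> G x"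
  unfolding exp_avg_def using assms by (intro integral_mono) auto

lemma exp_avg_antimono:
  assumes "\<nu> > 0" and "antimono F" and "\<And>y. \<bar>F y\<bar> \<le> B" and "F \<in> borel_measurable borel"
  shows "antimono (exp_avg \<nu> F)"
proof (rule antimonoI)
  fix x y :: real assume "x \<le> y"
  then show "exp_avg \<nu> F y \<le> exp_avg \<nu> F x"
    unfolding exp_avg_def using assms
    by (intro integral_mono exp_avg_integrable_bounded[where B = B] antimonoD[OF assms(2)]) auto
qed

lemma exp_avg_tendsto_at_bot:
  assumes \<nu>: "\<nu> > 0" and F [measurable]: "F \<in> borel_measurable borel"
    and B: "\<And>y. \<bar>F y\<bar> \<le> B" and lim: "(F \<longlongrightarrow> l) at_bot"
  shows "(exp_avg \<nu> F \<longlongrightarrow> l) at_bot"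
proof -
  interpret prob_space "density lborel (exponential_density \<nu>)"
    by (rule prob_space_exponential_density[OF \<nu>])
  have "((\<lambda>x. LINT s|density lborel (exponential_density \<nu>). F (- x + s))
      \<longlongrightarrow> (LINT s|density lborel (exponential_density \<nu>). l)) at_top"
  proof (rule integral_dominated_convergence_at_top[where w = "\<lambda>_. B"])
    show "AE s in density lborel (exponential_density \<nu>). ((\<lambda>x. F (- x + s)) \<longlongrightarrow> l) at_top"
    proof (rule AE_I2)
      fix s :: real
      have "filterlim (\<lambda>x. - x + s) at_bot at_top" by real_asymp
      then show "((\<lambda>x. F (- x + s)) \<longlongrightarrow> l) at_top"
        by (rule filterlim_compose[OF lim])
    qed
  qed (auto simp: B)
  then have "((\<lambda>x. exp_avg \<nu> F (- x)) \<longlongrightarrow> l) at_top"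
    using prob_space by (simp add: exp_avg_def)
  then show ?thesis
    by (simp add: filterlim_at_bot_mirror)
qed

text \<open>
  Translating the variable moves \<open>x\<close> from the integrand into the domain of integration, which
  is why the average is one order more regular than \<open>F\<close>.
\<close>

lemma exp_avg_eq_tail_integral:
  assumes \<nu>: "\<nu> > 0" and F [measurable]: "F \<in> borel_measurable borel"
  shows "exp_avg \<nu> F x = \<nu> * exp (\<nu> * x) * (LINT y:{x..}|lborel. exp (- \<nu> * y) * F y)"
proof -
  have "exp_avg \<nu> F x = (LINT s|lborel. exponential_density \<nu> s * F (x + s))"
    unfolding exp_avg_def using \<nu> by (subst integral_density) auto
  also have "\<dots> = (LINT s|lborel. (\<nu> * exp (\<nu> * x)) *
       (indicator {x..} (x + s) * (exp (- \<nu> * (x + s)) * F (x + s))))"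
    by (intro Bochner_Integration.integral_cong refl)
       (auto simp: exponential_density_def indicator_def mult_exp_exp algebra_simps)
  also have "\<dots> = (\<nu> * exp (\<nu> * x)) *
      (LINT s|lborel. indicator {x..} (x + s) * (exp (- \<nu> * (x + s)) * F (x + s)))"
    by (rule integral_mult_right_zero)
  also have "(LINT s|lborel. indicator {x..} (x + s) * (exp (- \<nu> * (x + s)) * F (x + s)))
     = (LINT y|lborel. indicator {x..} y * (exp (- \<nu> * y) * F y))"
    using lborel_integral_real_affine[of 1 "\<lambda>y. indicator {x..} y * (exp (- \<nu> * y) * F y)" x]
    by simp
  finally show ?thesis by (simp add: set_lebesgue_integral_def)
qed

lemma tail_integrable:
  fixes \<nu> B :: real
  assumes \<nu>: "\<nu> > 0" and F [measurable]: "F \<in> borel_measurable borel" and B: "\<And>y. \<bar>F y\<bar> \<le> B"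
  shows "set_integrable lborel {x..} (\<lambda>y. exp (- \<nu> * y) * F y)"
proof -
  have "integrable lborel (\<lambda>s. exponential_density \<nu> s *\<^sub>R F (x + s))"
    using exp_avg_integrable_bounded[OF assms, of x] \<nu>
    by (subst (asm) integrable_density) auto
  then have "integrable lborel (\<lambda>y. exponential_density \<nu> (- x + 1 * y) *\<^sub>R F (x + (- x + 1 * y)))"
    by (rule lborel_integrable_real_affine) simp
  then have "integrable lborel (\<lambda>y. (exp (- \<nu> * x) / \<nu>) *
      (exponential_density \<nu> (- x + 1 * y) *\<^sub>R F (x + (- x + 1 * y))))"
    by (rule integrable_mult_right)
  also have "(\<lambda>y. (exp (- \<nu> * x) / \<nu>) * (exponential_density \<nu> (- x + 1 * y) *\<^sub>R F (x + (- x + 1 * y))))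
     = (\<lambda>y. indicator {x..} y *\<^sub>R (exp (- \<nu> * y) * F y))"
    using \<nu> by (auto simp: exponential_density_def indicator_def mult_exp_exp algebra_simps fun_eq_iff)
  finally show ?thesis by (simp add: set_integrable_def)
qed

text \<open>
  Splitting the tail integral at \<open>x\<close> expresses the average through an indefinite integral
  over a compact interval, to which the fundamental theorem of calculus applies.
\<close>

lemma exp_avg_eq_on_interval:
  assumes \<nu>: "\<nu> > 0" and F [measurable]: "F \<in> borel_measurable borel" and B: "\<And>y. \<bar>F y\<bar> \<le> B"
    and ax: "a \<le> x"
  shows "(\<lambda>y. exp (- \<nu> * y) * F y) integrable_on {a..x}"
    and "exp_avg \<nu> F x =
      exp (\<nu> * x) * (exp (- \<nu> * a) * exp_avg \<nu> F a - \<nu> * integral {a..x} (\<lambda>y. exp (- \<nu> * y) * F y))"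
proof -
  let ?f = "\<lambda>y. exp (- \<nu> * y) * F y"
  have tail: "set_integrable lborel {z..} ?f" for z
    by (rule tail_integrable[OF \<nu> F B])
  have piece: "set_integrable lborel {a..x} ?f"
    by (rule set_integrable_subset[OF tail[of a]]) auto
  show "?f integrable_on {a..x}"
    using set_borel_integral_eq_integral(1)[OF piece] .
  have "(LINT y:{a..}|lborel. ?f y) = (LINT y:{a..x} \<union> {x<..}|lborel. ?f y)"
    using ax by (simp add: ivl_disj_un)
  also have "\<dots> = (LINT y:{a..x}|lborel. ?f y) + (LINT y:{x<..}|lborel. ?f y)"
    by (intro set_integral_Un piece set_integrable_subset[OF tail[of a]]) (use ax in auto)
  also have "(LINT y:{x<..}|lborel. ?f y) = (LINT y:{x..}|lborel. ?f y)"
    by (rule set_integral_cong_set)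
       (auto simp: set_borel_measurable_def intro!: AE_I'[of "{x}"])
  also have "(LINT y:{a..x}|lborel. ?f y) = integral {a..x} ?f"
    using set_borel_integral_eq_integral(2)[OF piece] .
  finally have split: "(LINT y:{x..}|lborel. ?f y) = (LINT y:{a..}|lborel. ?f y) - integral {a..x} ?f"
    by simp
  show "exp_avg \<nu> F x = exp (\<nu> * x) * (exp (- \<nu> * a) * exp_avg \<nu> F a - \<nu> * integral {a..x} ?f)"
    unfolding exp_avg_eq_tail_integral[OF \<nu> F] split by (simp add: exp_minus field_simps)
qed

lemma exp_avg_continuous:
  assumes \<nu>: "\<nu> > 0" and F: "F \<in> borel_measurable borel" and B: "\<And>y. \<bar>F y\<bar> \<le> B"
  shows "isCont (exp_avg \<nu> F) x"
proof -
  let ?f = "\<lambda>y. exp (- \<nu> * y) * F y"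
  define a where "a = x - 1"
  have "continuous_on {a..x+1} (\<lambda>z. integral {a..z} ?f)"
    by (intro indefinite_integral_continuous_1 exp_avg_eq_on_interval(1)[OF \<nu> F B]) (simp add: a_def)
  then have "continuous_on {a..x+1} (\<lambda>z. exp (\<nu> * z) * (exp (- \<nu> * a) * exp_avg \<nu> F a - \<nu> * integral {a..z} ?f))"
    by (intro continuous_intros)
  then have "continuous_on {a..x+1} (exp_avg \<nu> F)"
    by (rule continuous_on_eq) (use exp_avg_eq_on_interval(2)[OF \<nu> F B] in auto)
  then show ?thesis
    by (rule continuous_on_interior) (simp add: a_def)
qed

lemma exp_avg_has_derivative:
  assumes \<nu>: "\<nu> > 0" and F: "continuous_on UNIV F" and B: "\<And>y. \<bar>F y\<bar> \<le> B"
  shows "(exp_avg \<nu> F has_real_derivative \<nu> * (exp_avg \<nu> F x - F x)) (at x)"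
proof -
  let ?f = "\<lambda>y. exp (- \<nu> * y) * F y"
  have Fm: "F \<in> borel_measurable borel" using F by (rule borel_measurable_continuous_onI)
  define a where "a = x - 1"
  have x: "x \<in> {a<..<x+1}" by (simp add: a_def)
  have rep: "exp_avg \<nu> F z = exp (\<nu> * z) * (exp (- \<nu> * a) * exp_avg \<nu> F a - \<nu> * integral {a..z} ?f)"
    if "z \<in> {a<..<x+1}" for z
    using that by (intro exp_avg_eq_on_interval(2)[OF \<nu> Fm B]) simp
  have f_cont: "continuous_on {a..x+1} ?f"
    by (intro continuous_intros continuous_on_subset[OF F]) simp_all
  have "((\<lambda>z. integral {a..z} ?f) has_real_derivative ?f x) (at x within {a..x+1})"
    by (rule integral_has_real_derivative[OF f_cont]) (simp add: a_def)
  then have "((\<lambda>z. integral {a..z} ?f) has_real_derivative ?f x) (at x)"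
    unfolding at_within_Icc_at[OF x[unfolded greaterThanLessThan_iff, THEN conjunct1] x[unfolded greaterThanLessThan_iff, THEN conjunct2]] .
  then have "((\<lambda>z. exp (- \<nu> * a) * exp_avg \<nu> F a - \<nu> * integral {a..z} ?f) has_real_derivative
      0 - \<nu> * ?f x) (at x)"
    by (intro DERIV_diff DERIV_const DERIV_cmult)
  moreover have "((\<lambda>z. exp (\<nu> * z)) has_real_derivative exp (\<nu> * x) * \<nu>) (at x)"
    by (auto intro!: derivative_eq_intros)
  ultimately have "((\<lambda>z. exp (\<nu> * z) * (exp (- \<nu> * a) * exp_avg \<nu> F a - \<nu> * integral {a..z} ?f))
      has_real_derivative exp (\<nu> * x) * (0 - \<nu> * ?f x) +
        (exp (\<nu> * x) * \<nu>) * (exp (- \<nu> * a) * exp_avg \<nu> F a - \<nu> * integral {a..x} ?f)) (at x)"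
    by (rule DERIV_mult'[rotated])
  also have "exp (\<nu> * x) * (0 - \<nu> * ?f x) +
        (exp (\<nu> * x) * \<nu>) * (exp (- \<nu> * a) * exp_avg \<nu> F a - \<nu> * integral {a..x} ?f) = \<nu> * (exp_avg \<nu> F x - F x)"
    by (simp add: rep[OF x] exp_minus algebra_simps)
  finally show ?thesis
    by (rule DERIV_cong_ev[THEN iffD1, OF refl _ refl, rotated])
       (use x rep in \<open>auto intro!: eventually_mono[OF eventually_nhds_in_open[of "{a<..<x+1}"]]\<close>)
qed

section \<open>Closure properties of C_k functions\<close>

lemma C_k_0 [simp]: "C_k 0 f \<longleftrightarrow> continuous_on UNIV f"
  by (simp add: C_k_def)

lemma C_k_Suc: "C_k (Suc k) f \<longleftrightarrow> (\<forall>x. f differentiable (at x)) \<and> C_k k (deriv f)"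
proof -
  have *: "(deriv ^^ Suc i) f = (deriv ^^ i) (deriv f)" for i
    by (simp add: funpow_swap1)
  show ?thesis
    unfolding C_k_def All_less_Suc2 * by auto
qed

text \<open>
  The recursive form of the smoothness class, in which a step of the induction on \<open>k\<close> replaces
  a function by its derivative, drives all the closure proofs below.
\<close>

lemma C_k_SucI:
  assumes "\<And>x. (f has_real_derivative f' x) (at x)" and "C_k k f'"
  shows "C_k (Suc k) f"
proof -
  have "deriv f = f'" using assms(1) by (auto intro: DERIV_imp_deriv)
  then show ?thesis using assms by (auto simp: C_k_Suc real_differentiable_def)
qed

lemma C_k_SucD:
  assumes "C_k (Suc k) f"
  shows "(f has_real_derivative deriv f x) (at x)" and "C_k k (deriv f)"
  using assms by (auto simp: C_k_Suc DERIV_deriv_iff_real_differentiable)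

lemma C_k_pred: "C_k (Suc k) f \<Longrightarrow> C_k k f"
proof (induction k arbitrary: f)
  case 0
  then show ?case
    using DERIV_continuous_on[of UNIV f "deriv f"] C_k_SucD(1) by auto
next
  case (Suc k)
  then show ?case by (simp add: C_k_Suc[of "Suc k"] C_k_Suc[of k])
qed

lemma C_k_mono: "j \<le> k \<Longrightarrow> C_k k f \<Longrightarrow> C_k j f"
  by (induction rule: inc_induct) (blast, rule C_k_pred)

lemma C_k_add: "C_k k f \<Longrightarrow> C_k k g \<Longrightarrow> C_k k (\<lambda>x. f x + g x)"
proof (induction k arbitrary: f g)
  case 0
  then show ?case by (simp add: continuous_on_add)
next
  case (Suc k)
  show ?case
  proof (rule C_k_SucI)
    show "((\<lambda>x. f x + g x) has_real_derivative deriv f x + deriv g x) (at x)" for x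
      using Suc.prems[THEN C_k_SucD(1)] by (rule DERIV_add)
    show "C_k k (\<lambda>x. deriv f x + deriv g x)"
      using Suc.prems by (intro Suc.IH C_k_SucD(2))
  qed
qed

lemma C_k_mult: "C_k k f \<Longrightarrow> C_k k g \<Longrightarrow> C_k k (\<lambda>x. f x * g x)"
proof (induction k arbitrary: f g)
  case 0
  then show ?case by (simp add: continuous_on_mult)
next
  case (Suc k)
  show ?case
  proof (rule C_k_SucI)
    show "((\<lambda>x. f x * g x) has_real_derivative deriv f x * g x + f x * deriv g x) (at x)" for x
      using DERIV_mult'[OF Suc.prems[THEN C_k_SucD(1)]] by (simp add: add.commute)
    show "C_k k (\<lambda>x. deriv f x * g x + f x * deriv g x)"
      by (intro C_k_add Suc.IH Suc.prems[THEN C_k_SucD(2)] Suc.prems[THEN C_k_pred])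
  qed
qed

lemma C_k_const: "C_k k (\<lambda>_. a)"
proof (induction k arbitrary: a)
  case (Suc k)
  show ?case by (rule C_k_SucI[OF DERIV_const Suc.IH])
qed simp

lemma C_k_compose: "C_k k f \<Longrightarrow> C_k k g \<Longrightarrow> C_k k (\<lambda>x. g (f x))"
proof (induction k arbitrary: f g)
  case 0
  then show ?case using continuous_on_compose2[of UNIV g UNIV f] by simp
next
  case (Suc k)
  show ?case
  proof (rule C_k_SucI)
    show "((\<lambda>x. g (f x)) has_real_derivative deriv g (f x) * deriv f x) (at x)" for x
      by (rule DERIV_chain2[OF Suc.prems(2)[THEN C_k_SucD(1)] Suc.prems(1)[THEN C_k_SucD(1)]])
    show "C_k k (\<lambda>x. deriv g (f x) * deriv f x)"
      using C_k_mult[OF Suc.IH[OF Suc.prems(1)[THEN C_k_pred] Suc.prems(2)[THEN C_k_SucD(2)]]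
          Suc.prems(1)[THEN C_k_SucD(2)]] .
  qed
qed

lemma C_k_id: "C_k k (\<lambda>x. x)"
proof (cases k)
  case (Suc j)
  show ?thesis unfolding Suc by (rule C_k_SucI[OF DERIV_ident C_k_const])
qed simp

section \<open>Fixed points of monotone operators on antitone functions\<close>

text \<open>
  The Knaster--Tarski argument: the pointwise infimum of all \<open>f\<close> with \<open>T f \<le> f\<close> is again
  antitone and between the barriers, and is a fixed point.  Antitonicity survives infima
  of uncountable families and entails measurability, so that \<open>T\<close> may contain an integral.
\<close>

lemma antimono_fixed_point_between:
  fixes T :: "(real \<Rightarrow> real) \<Rightarrow> real \<Rightarrow> real" and lo hi :: "real \<Rightarrow> real"
  defines "S \<equiv> {f. antimono f \<and> (\<forall>x. lo x \<le> f x \<and> f x \<le> hi x)}"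
  assumes hi: "hi \<in> S"
    and maps: "\<And>f. f \<in> S \<Longrightarrow> T f \<in> S"
    and mono: "\<And>f f' x. f \<in> S \<Longrightarrow> f' \<in> S \<Longrightarrow> (\<And>y. f y \<le> f' y) \<Longrightarrow> T f x \<le> T f' x"
  obtains \<phi> where "\<phi> \<in> S" "T \<phi> = \<phi>"
proof -
  define P where "P = {f \<in> S. \<forall>x. T f x \<le> f x}"
  define \<phi> where "\<phi> x = (INF f\<in>P. f x)" for x
  have hiP: "hi \<in> P" using hi maps[OF hi] by (auto simp: P_def S_def)
  have lower: "lo x \<le> f x" if "f \<in> P" for f x using that by (auto simp: P_def S_def)
  have \<phi>_le: "\<phi> x \<le> f x" if "f \<in> P" for f x
    unfolding \<phi>_def by (rule cINF_lower[OF bdd_belowI2[of P "lo x"] that]) (rule lower)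
  have \<phi>_ge: "z \<le> \<phi> x" if "\<And>f. f \<in> P \<Longrightarrow> z \<le> f x" for z x
    unfolding \<phi>_def by (rule cINF_greatest) (use hiP that in auto)
  have \<phi>S: "\<phi> \<in> S"
  proof -
    have "antimono \<phi>"
    proof (rule antimonoI)
      fix x y :: real assume "x \<le> y"
      then show "\<phi> y \<le> \<phi> x"
        by (intro \<phi>_ge order_trans[OF \<phi>_le]) (auto simp: P_def S_def dest: antimonoD)
    qed
    moreover have "lo x \<le> \<phi> x" for x by (rule \<phi>_ge) (rule lower)
    ultimately show ?thesis
      using \<phi>_le[OF hiP] by (simp add: S_def)
  qed
  have le: "T \<phi> x \<le> \<phi> x" for x
  proof (rule \<phi>_ge)
    fix f assume f: "f \<in> P"
    then have "T \<phi> x \<le> T f x" by (intro mono \<phi>S \<phi>_le) (auto simp: P_def)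
    also have "\<dots> \<le> f x" using f by (auto simp: P_def)
    finally show "T \<phi> x \<le> f x" .
  qed
  have "T \<phi> \<in> P"
    unfolding P_def using maps[OF \<phi>S] by (auto intro: mono[OF _ \<phi>S] le)
  then have "T \<phi> = \<phi>" using \<phi>_le le by (auto intro!: antisym simp: fun_eq_iff)
  then show thesis using \<phi>S that by blast
qed

section \<open>The dispersion relation\<close>

text \<open>
  The symbol of the discrete Laplacian plus the linear reaction: applying them to
  \<open>exp (- a x)\<close> multiplies it by this factor.
\<close>

definition dispersion :: "real \<Rightarrow> real \<Rightarrow> real \<Rightarrow> real" where
  "dispersion h r a = (exp (a * h) + exp (- a * h) - 2) / h\<^sup>2 + r"

lemma dispersion_tendsto:
  "((\<lambda>h. dispersion h r a) \<longlongrightarrow> a\<^sup>2 + r) (at_right 0)"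
  unfolding dispersion_def power2_eq_square[of a] by real_asymp

lemma dispersion_convex: "convex_on UNIV (dispersion h r)"
proof -
  have e: "convex_on UNIV (\<lambda>a::real. exp (b * a))" for b
    by (rule f''_ge0_imp_convex[where f' = "\<lambda>a. b * exp (b * a)" and f'' = "\<lambda>a. b\<^sup>2 * exp (b * a)"])
       (auto intro!: derivative_eq_intros simp: power2_eq_square)
  have "convex_on UNIV (\<lambda>a. (1 / h\<^sup>2) * (exp (h * a) + exp ((- h) * a)) + (r - 2 / h\<^sup>2))"
    by (intro convex_on_add convex_on_cmul e) (simp_all add: convex_on_const)
  also have "(\<lambda>a. (1 / h\<^sup>2) * (exp (h * a) + exp ((- h) * a)) + (r - 2 / h\<^sup>2)) = dispersion h r"
    by (simp add: dispersion_def fun_eq_iff diff_divide_distrib add_divide_distrib algebra_simps)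
  finally show ?thesis .
qed

text \<open>
  The number \<open>\<alpha>\<close> is the decay rate of the wave; \<open>\<kappa>\<close> is the faster rate of the
  correction in the subsolution.  The bound \<open>\<kappa> \<le> 2 \<alpha>\<close> ensures that the square of
  \<open>exp (- \<alpha> x)\<close> is dominated by \<open>exp (- \<kappa> x)\<close> for \<open>x \<ge> 0\<close>.
\<close>

lemma dispersion_roots:
  assumes r: "r > 0" and b: "b > 0" and neg: "dispersion h r b < c * b"
  obtains \<alpha> \<kappa> where "0 < \<alpha>" "\<alpha> < \<kappa>" "\<kappa> \<le> 2 * \<alpha>" "dispersion h r \<alpha> = c * \<alpha>" "dispersion h r \<kappa> < c * \<kappa>"
proof -
  define p where "p a = dispersion h r a - c * a" for a
  have p0: "p 0 > 0" using r by (simp add: p_def dispersion_def)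
  have pb: "p b < 0" using neg by (simp add: p_def)
  have "continuous_on {0..b} p"
    unfolding p_def dispersion_def divide_inverse by (intro continuous_intros)
  then obtain \<alpha> where \<alpha>: "0 \<le> \<alpha>" "\<alpha> \<le> b" "p \<alpha> = 0"
    using IVT2'[of p b 0 0] p0 pb b by auto
  then have \<alpha>': "0 < \<alpha>" "\<alpha> < b" using p0 pb by (auto simp: less_le)
  \<comment> \<open>Convexity makes the chord from \<open>\<alpha>\<close> to \<open>b\<close> an upper bound, so any point strictly after \<open>\<alpha>\<close> and up to \<open>b\<close> works.\<close>
  define \<kappa> where "\<kappa> = min b (2 * \<alpha>)"
  have \<kappa>: "\<alpha> < \<kappa>" "\<kappa> \<le> b" "\<kappa> \<le> 2 * \<alpha>" using \<alpha>' by (auto simp: \<kappa>_def)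
  define t where "t = (\<kappa> - \<alpha>) / (b - \<alpha>)"
  have t: "0 < t" "t \<le> 1" using \<kappa> \<alpha>' by (auto simp: t_def)
  have comb: "\<kappa> = (1 - t) * \<alpha> + t * b"
  proof -
    have "t * (b - \<alpha>) = \<kappa> - \<alpha>" using \<alpha>' by (simp add: t_def)
    then show ?thesis by (simp add: algebra_simps)
  qed
  have "dispersion h r \<kappa> \<le> (1 - t) * dispersion h r \<alpha> + t * dispersion h r b"
    using convex_onD[OF dispersion_convex, of t \<alpha> b] t comb by simp
  also have "\<dots> < (1 - t) * (c * \<alpha>) + t * (c * b)"
    using \<alpha>(3) neg t by (simp add: p_def)
  also have "\<dots> = c * \<kappa>" by (simp add: comb algebra_simps)
  finally show thesis using that \<alpha>' \<kappa> \<alpha>(3) by (simp add: p_def)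
qed

section \<open>Travelling profiles between exponential barriers\<close>

text \<open>
  One fixed lattice spacing, with the properties of the reaction term that the construction uses.
  The constant \<open>m\<close> compensates a decrease of \<open>g\<close>, \<open>r\<close> is the growth rate at 0, \<open>L\<close> bounds
  the deviation from linear growth, and \<open>M\<close> is the weight of the correction in the subsolution.
\<close>

locale kpp_lattice =
  fixes g :: "real \<Rightarrow> real" and c h m r L \<alpha> \<kappa> M :: real
  assumes c: "c > 0" and h: "h > 0" and m: "m > 0" and r: "r > 0" and M: "M \<ge> 1"
    and g0: "g 0 = 0" and g1: "g 1 = 0"
    and g_nz: "\<And>u. 0 < u \<Longrightarrow> u < 1 \<Longrightarrow> g u \<noteq> 0"
    and g_cont: "continuous_on UNIV g"
    and g_mono: "\<And>u v. 0 \<le> u \<Longrightarrow> u \<le> v \<Longrightarrow> v \<le> 1 \<Longrightarrow> g u + m * u \<le> g v + m * v"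
    and g_upper: "\<And>u. 0 \<le> u \<Longrightarrow> u \<le> 1 \<Longrightarrow> g u \<le> r * u"
    and g_lower: "\<And>u. 0 \<le> u \<Longrightarrow> u \<le> 1 \<Longrightarrow> r * u - L * u\<^sup>2 \<le> g u"
    and L: "L \<ge> 0"
    and \<alpha>: "\<alpha> > 0" and \<kappa>: "\<alpha> < \<kappa>" "\<kappa> \<le> 2 * \<alpha>"
    and disp_\<alpha>: "dispersion h r \<alpha> = c * \<alpha>"
    and disp_\<kappa>: "L \<le> M * (c * \<kappa> - dispersion h r \<kappa>)"
begin

text \<open>
  The shift \<open>\<mu>\<close> cancels the negative contributions \<open>- 2 f y / h\<^sup>2\<close> of the discrete Laplacian
  and the possible decrease of \<open>g\<close>: \<open>H f\<close> is the right-hand side of the profile equation plus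
  \<open>\<mu> f\<close>.
\<close>

definition \<mu> :: real where "\<mu> = m + 2 / h\<^sup>2"

definition H :: "(real \<Rightarrow> real) \<Rightarrow> real \<Rightarrow> real" where
  "H f y = (f (y + h) + f (y - h)) / h\<^sup>2 + (g (f y) + m * f y)"

text \<open>
  The profile equation \<open>\<mu> f - c f' = H f\<close> is the fixed-point equation of \<open>T\<close>.
\<close>

definition T :: "(real \<Rightarrow> real) \<Rightarrow> real \<Rightarrow> real" where
  "T f x = exp_avg (\<mu> / c) (H f) x / \<mu>"

definition lo :: "real \<Rightarrow> real" where "lo y = max 0 (exp (- \<alpha> * y) - M * exp (- \<kappa> * y))"
definition hi :: "real \<Rightarrow> real" where "hi y = min 1 (exp (- \<alpha> * y))"

definition S :: "(real \<Rightarrow> real) set" where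
  "S = {f. antimono f \<and> (\<forall>x. lo x \<le> f x \<and> f x \<le> hi x)}"

lemma \<mu>_pos: "\<mu> > 0" using m h by (simp add: \<mu>_def add_pos_pos)

lemma rate_pos: "\<mu> / c > 0" using \<mu>_pos c by simp

lemma S_range:
  assumes "f \<in> S" shows "0 \<le> f y" "f y \<le> 1"
proof -
  have "lo y \<le> f y" "f y \<le> hi y" using assms by (auto simp: S_def)
  then show "0 \<le> f y" "f y \<le> 1" by (auto simp: lo_def hi_def)
qed

text \<open>
  The lower barrier is confined to the half-line where \<open>exp (- \<alpha> y) < 1\<close>, which
  puts it below the upper one, and where \<open>exp (- 2 \<alpha> y) \<le> exp (- \<kappa> y)\<close>, which controls
  the quadratic error of the linearisation.
\<close>

lemma lo_pos_imp: "exp (- \<alpha> * y) - M * exp (- \<kappa> * y) > 0 \<Longrightarrow> y > 0"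
proof (rule ccontr)
  assume *: "exp (- \<alpha> * y) - M * exp (- \<kappa> * y) > 0" and "\<not> y > 0"
  then have "(\<kappa> - \<alpha>) * y \<le> 0" using \<kappa> by (simp add: mult_le_0_iff)
  then have "exp (- \<alpha> * y) \<le> 1 * exp (- \<kappa> * y)" by (simp add: algebra_simps)
  also have "\<dots> \<le> M * exp (- \<kappa> * y)" using M by (intro mult_right_mono) auto
  finally show False using * by simp
qed

lemma lo_le_hi: "lo y \<le> hi y"
proof (cases "exp (- \<alpha> * y) - M * exp (- \<kappa> * y) > 0")
  case True
  have "y > 0" using lo_pos_imp[OF True] .
  then have "exp (- \<alpha> * y) \<le> 1" using \<alpha> by simp
  moreover have "M * exp (- \<kappa> * y) > 0" using M by simp
  ultimately show ?thesis unfolding lo_def hi_def by auto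
next
  case False
  then show ?thesis unfolding lo_def hi_def by auto
qed

lemma hi_in_S: "hi \<in> S"
proof -
  have "antimono hi"
  proof (rule antimonoI)
    fix x y :: real assume "x \<le> y"
    then have "exp (- \<alpha> * y) \<le> exp (- \<alpha> * x)" using \<alpha> by simp
    then show "hi y \<le> hi x" unfolding hi_def by linarith
  qed
  then show ?thesis by (simp add: S_def lo_le_hi)
qed

lemma H_mono_pointwise:
  assumes "f (y + h) \<le> f' (z + h)" "f (y - h) \<le> f' (z - h)" "0 \<le> f y" "f y \<le> f' z" "f' z \<le> 1"
  shows "H f y \<le> H f' z"
  unfolding H_def using assms by (intro add_mono divide_right_mono g_mono) auto

lemma H_antimono:
  assumes "f \<in> S" shows "antimono (H f)"
proof -
  have anti: "antimono f" using assms by (simp add: S_def)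
  show ?thesis
    by (intro antimonoI H_mono_pointwise antimonoD[OF anti] S_range[OF assms]) auto
qed

lemma H_range:
  assumes "f \<in> S" shows "0 \<le> H f y" "H f y \<le> \<mu>"
proof -
  have "H (\<lambda>_. 0) y \<le> H f y" "H f y \<le> H (\<lambda>_. 1) y"
    by (intro H_mono_pointwise; use S_range[OF assms] in simp)+
  then show "0 \<le> H f y" "H f y \<le> \<mu>"
    by (simp_all add: H_def \<mu>_def g0 g1)
qed

lemma H_measurable: 
  assumes "f \<in> S" shows "H f \<in> borel_measurable borel"
proof -
  have "mono (\<lambda>y. - H f y)" using H_antimono[OF assms] by (auto simp: monotone_def)
  then have "(\<lambda>y. - (- H f y)) \<in> borel_measurable borel"
    by (intro borel_measurable_uminus borel_measurable_mono)
  then show ?thesis by simp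
qed

lemma H_abs_le: "f \<in> S \<Longrightarrow> \<bar>H f y\<bar> \<le> \<mu>"
  using H_range[of f y] by simp

lemma H_integrable:
  "f \<in> S \<Longrightarrow> integrable (density lborel (exponential_density (\<mu> / c))) (\<lambda>s. H f (x + s))"
  by (rule exp_avg_integrable_bounded[OF rate_pos H_measurable H_abs_le])

text \<open>
  The factor \<open>c a + \<mu>\<close> is the value of \<open>\<mu> - c d/dx\<close> on \<open>exp (- a x)\<close>, so that exponential
  bounds on \<open>H f\<close> with these factors pass unchanged to \<open>T f\<close>.
\<close>

lemma exp_mode:
  assumes "a > 0"
  shows "integrable (density lborel (exponential_density (\<mu> / c))) (\<lambda>s. (c * a + \<mu>) * exp (- a * (x + s)))"
    and "(LINT s|density lborel (exponential_density (\<mu> / c)). (c * a + \<mu>) * exp (- a * (x + s)))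
      = \<mu> * exp (- a * x)"
proof -
  show "integrable (density lborel (exponential_density (\<mu> / c))) (\<lambda>s. (c * a + \<mu>) * exp (- a * (x + s)))"
    by (intro integrable_mult_right exp_avg_exponential(1)[OF rate_pos assms])
  have "(\<mu> / c) / (\<mu> / c + a) = \<mu> / (c * a + \<mu>)"
    using c \<mu>_pos assms by (simp add: field_simps)
  moreover have "c * a + \<mu> > 0" using c assms \<mu>_pos by (simp add: add_pos_pos)
  ultimately show "(LINT s|density lborel (exponential_density (\<mu> / c)). (c * a + \<mu>) * exp (- a * (x + s)))
      = \<mu> * exp (- a * x)"
    using exp_avg_exponential(2)[OF rate_pos assms, of x]
    by (simp only: integral_mult_right_zero exp_avg_def) simp
qed

text \<open>
  The supersolution property: \<open>H\<close> is dominated by its linearisation at 0, for which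
  \<open>exp (- \<alpha> x)\<close> is an exact solution.
\<close>

lemma H_upper:
  assumes "f \<in> S" shows "H f y \<le> (c * \<alpha> + \<mu>) * exp (- \<alpha> * y)"
proof -
  have le: "f z \<le> exp (- \<alpha> * z)" for z using assms by (auto simp: S_def hi_def)
  have "g (f y) + m * f y \<le> r * f y + m * f y"
    using g_upper S_range[OF assms] by simp
  also have "\<dots> = (r + m) * f y" by (simp add: algebra_simps)
  also have "\<dots> \<le> (r + m) * exp (- \<alpha> * y)"
    using le r m by (intro mult_left_mono) auto
  finally have "H f y \<le> (exp (- \<alpha> * (y + h)) + exp (- \<alpha> * (y - h))) / h\<^sup>2 + (r + m) * exp (- \<alpha> * y)"
    unfolding H_def by (intro add_mono divide_right_mono le) auto
  also have "\<dots> = (dispersion h r \<alpha> + \<mu>) * exp (- \<alpha> * y)"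
    using h by (simp add: dispersion_def \<mu>_def field_simps mult_exp_exp power2_eq_square)
  finally show ?thesis by (simp add: disp_\<alpha>)
qed

text \<open>
  The subsolution property.  The linearised operator applied to the correction gains
  \<open>M (c \<kappa> - dispersion h r \<kappa>) exp (- \<kappa> y)\<close>, which absorbs the quadratic error
  \<open>L (w y)\<^sup>2\<close>.  Where the lower barrier \<open>w\<close> is negative there is no error to absorb,
  because \<open>g u + m u\<close> is nonnegative.
\<close>

lemma H_lower:
  assumes "f \<in> S"
  shows "(c * \<alpha> + \<mu>) * exp (- \<alpha> * y) - M * ((c * \<kappa> + \<mu>) * exp (- \<kappa> * y)) \<le> H f y"
proof -
  define w where "w z = exp (- \<alpha> * z) - M * exp (- \<kappa> * z)" for z
  have le: "max 0 (w z) \<le> f z" for z using assms by (auto simp: S_def lo_def w_def)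
  have w_le: "w z \<le> f z" for z using le[of z] by simp
  have reaction: "(r + m) * w y - L * exp (- \<kappa> * y) \<le> g (f y) + m * f y"
  proof (cases "w y > 0")
    case True
    then have y: "y > 0" using lo_pos_imp by (simp add: w_def)
    have w1: "w y \<le> 1" using w_le[of y] S_range[OF assms, of y] by simp
    have "w y \<le> exp (- \<alpha> * y)" using M by (simp add: w_def)
    then have "(w y)\<^sup>2 \<le> (exp (- \<alpha> * y))\<^sup>2" using True by (intro power_mono) auto
    also have "\<dots> = exp (- (2 * \<alpha>) * y)" by (simp add: power2_eq_square mult_exp_exp)
    also have "\<dots> \<le> exp (- \<kappa> * y)" using \<kappa> y by simp
    finally have "L * (w y)\<^sup>2 \<le> L * exp (- \<kappa> * y)" using L by (intro mult_left_mono)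
    then have "(r + m) * w y - L * exp (- \<kappa> * y) \<le> (r * w y - L * (w y)\<^sup>2) + m * w y"
      by (simp add: algebra_simps)
    also have "\<dots> \<le> g (w y) + m * w y" using g_lower[of "w y"] True w1 by simp
    also have "\<dots> \<le> g (f y) + m * f y"
      using True w_le S_range[OF assms] by (intro g_mono) auto
    finally show ?thesis .
  next
    case False
    then have "(r + m) * w y \<le> 0" using r m by (simp add: mult_le_0_iff)
    moreover have "0 \<le> L * exp (- \<kappa> * y)" using L by simp
    moreover have "0 \<le> g (f y) + m * f y" using g_mono[of 0 "f y"] S_range[OF assms] by (simp add: g0)
    ultimately show ?thesis by linarith
  qed
  have "L * exp (- \<kappa> * y) \<le> M * (c * \<kappa> - dispersion h r \<kappa>) * exp (- \<kappa> * y)"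
    using disp_\<kappa> by (intro mult_right_mono) auto
  then have "(c * \<alpha> + \<mu>) * exp (- \<alpha> * y) - M * ((c * \<kappa> + \<mu>) * exp (- \<kappa> * y))
     \<le> (dispersion h r \<alpha> + \<mu>) * exp (- \<alpha> * y) - M * ((dispersion h r \<kappa> + \<mu>) * exp (- \<kappa> * y))
        - L * exp (- \<kappa> * y)"
    by (simp add: disp_\<alpha> algebra_simps)
  also have "(dispersion h r \<alpha> + \<mu>) * exp (- \<alpha> * y) - M * ((dispersion h r \<kappa> + \<mu>) * exp (- \<kappa> * y))
     = (w (y + h) + w (y - h)) / h\<^sup>2 + (r + m) * w y"
    using h by (simp add: dispersion_def w_def \<mu>_def field_simps mult_exp_exp power2_eq_square)
  also have "\<dots> - L * exp (- \<kappa> * y) \<le> H f y"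
    using reaction divide_right_mono[OF add_mono[OF w_le[of "y + h"] w_le[of "y - h"]], of "h\<^sup>2"]
    unfolding H_def by simp
  finally show ?thesis .
qed

text \<open>
  Averaging fixes constants and turns \<open>(c a + \<mu>) exp (- a x)\<close> into \<open>\<mu> exp (- a x)\<close>, so
  after division by \<open>\<mu>\<close> the bounds on \<open>H f\<close> are exactly the barriers.
\<close>

lemma T_maps:
  assumes f: "f \<in> S" shows "T f \<in> S"
proof -
  have anti: "antimono (T f)"
  proof (rule antimonoI)
    fix x y :: real assume "x \<le> y"
    then have "exp_avg (\<mu> / c) (H f) y \<le> exp_avg (\<mu> / c) (H f) x"
      using antimonoD[OF exp_avg_antimono[OF rate_pos H_antimono[OF f] H_abs_le[OF f] H_measurable[OF f]]] by blast
    then show "T f y \<le> T f x" using \<mu>_pos by (simp add: T_def divide_right_mono)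
  qed
  have "T f x \<ge> 0" for x
    unfolding T_def exp_avg_def using H_range(1)[OF f] \<mu>_pos
    by (intro divide_nonneg_pos integral_nonneg_AE) auto
  moreover have "T f x \<le> 1" for x
  proof -
    have "exp_avg (\<mu> / c) (H f) x \<le> exp_avg (\<mu> / c) (\<lambda>_. \<mu>) x"
      using H_range(2)[OF f] by (intro exp_avg_mono H_integrable[OF f]
          exp_avg_integrable_bounded[OF rate_pos, of "\<lambda>_. \<mu>" "\<bar>\<mu>\<bar>"]) auto
    then show ?thesis using \<mu>_pos by (simp add: T_def exp_avg_const[OF rate_pos])
  qed
  moreover have "T f x \<le> exp (- \<alpha> * x)" for x
  proof -
    have "exp_avg (\<mu> / c) (H f) x \<le> \<mu> * exp (- \<alpha> * x)"
      unfolding exp_avg_def exp_mode(2)[OF \<alpha>, symmetric]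
      by (intro integral_mono H_integrable[OF f] exp_mode(1)[OF \<alpha>] H_upper[OF f])
    then show ?thesis using \<mu>_pos by (simp add: T_def field_simps)
  qed
  moreover have "exp (- \<alpha> * x) - M * exp (- \<kappa> * x) \<le> T f x" for x
  proof -
    have \<kappa>0: "\<kappa> > 0" using \<alpha> \<kappa> by simp
    have "\<mu> * exp (- \<alpha> * x) - M * (\<mu> * exp (- \<kappa> * x))
      = (LINT s|density lborel (exponential_density (\<mu> / c)).
          (c * \<alpha> + \<mu>) * exp (- \<alpha> * (x + s)) - M * ((c * \<kappa> + \<mu>) * exp (- \<kappa> * (x + s))))"
      using Bochner_Integration.integral_diff[OF exp_mode(1)[OF \<alpha>]
          integrable_mult_right[OF exp_mode(1)[OF \<kappa>0], of M]]
      by (simp only: exp_mode(2)[OF \<alpha>] exp_mode(2)[OF \<kappa>0] integral_mult_right_zero[where c = M])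
    also have "\<dots> \<le> exp_avg (\<mu> / c) (H f) x"
      unfolding exp_avg_def
      by (intro integral_mono H_integrable[OF f] Bochner_Integration.integrable_diff
          integrable_mult_right[OF exp_mode(1)[OF \<kappa>0]] exp_mode(1)[OF \<alpha>] H_lower[OF f])
    finally show ?thesis using \<mu>_pos by (simp add: T_def field_simps)
  qed
  ultimately show ?thesis using anti by (simp add: S_def lo_def hi_def)
qed

lemma T_mono:
  assumes "f \<in> S" "f' \<in> S" "\<And>y. f y \<le> f' y"
  shows "T f x \<le> T f' x"
proof -
  have "exp_avg (\<mu> / c) (H f) x \<le> exp_avg (\<mu> / c) (H f') x"
    using assms S_range by (intro exp_avg_mono H_integrable H_mono_pointwise) auto
  then show ?thesis using \<mu>_pos by (simp add: T_def divide_right_mono)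
qed

lemma profile_continuous:
  assumes "\<phi> \<in> S" "T \<phi> = \<phi>" shows "continuous_on UNIV \<phi>"
proof -
  have "isCont (\<lambda>x. exp_avg (\<mu> / c) (H \<phi>) x / \<mu>) x" for x
    using exp_avg_continuous[OF rate_pos H_measurable H_abs_le] assms(1) \<mu>_pos
    by (intro continuous_divide) auto
  then have "isCont (T \<phi>) x" for x by (simp add: T_def[abs_def])
  then show ?thesis using assms(2) by (simp add: continuous_at_imp_continuous_on)
qed

lemma profile_derivative:
  assumes \<phi>: "\<phi> \<in> S" "T \<phi> = \<phi>"
  shows "(\<phi> has_real_derivative
    (- 1 / c) * ((\<phi> (x + h) - 2 * \<phi> x + \<phi> (x - h)) / h\<^sup>2 + g (\<phi> x))) (at x)"
proof -
  have cont: "continuous_on UNIV \<phi>" by (rule profile_continuous[OF \<phi>])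
  have "continuous_on UNIV (H \<phi>)"
    unfolding H_def[abs_def] using h
    by (intro continuous_intros continuous_on_compose2[OF cont] continuous_on_compose2[OF g_cont]) auto
  then have "((\<lambda>x. exp_avg (\<mu> / c) (H \<phi>) x / \<mu>) has_real_derivative
      (\<mu> / c) * (exp_avg (\<mu> / c) (H \<phi>) x - H \<phi> x) / \<mu>) (at x)"
    by (intro DERIV_cdivide exp_avg_has_derivative[OF rate_pos _ H_abs_le[OF \<phi>(1)]])
  moreover have "(\<lambda>x. exp_avg (\<mu> / c) (H \<phi>) x / \<mu>) = \<phi>"
    using \<phi>(2) by (simp add: T_def[abs_def])
  moreover have avg: "exp_avg (\<mu> / c) (H \<phi>) x = \<mu> * \<phi> x"
    using fun_cong[OF \<phi>(2), of x] \<mu>_pos by (simp add: T_def field_simps)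
  moreover have "(\<mu> / c) * (\<mu> * \<phi> x - H \<phi> x) / \<mu>
      = (- 1 / c) * ((\<phi> (x + h) - 2 * \<phi> x + \<phi> (x - h)) / h\<^sup>2 + g (\<phi> x))"
  proof -
    have "(\<mu> / c) * (\<mu> * \<phi> x - H \<phi> x) / \<mu> = (- 1 / c) * (H \<phi> x - \<mu> * \<phi> x)"
      using \<mu>_pos c by (simp add: field_simps)
    also have "H \<phi> x - \<mu> * \<phi> x = (\<phi> (x + h) - 2 * \<phi> x + \<phi> (x - h)) / h\<^sup>2 + g (\<phi> x)"
      by (simp add: H_def \<mu>_def diff_divide_distrib add_divide_distrib algebra_simps)
    finally show ?thesis .
  qed
  ultimately show ?thesis by simp
qed

text \<open>
  Bootstrapping: the derivative of the profile is a smooth expression in the profile and its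
  shifts, limited only by the smoothness of \<open>g\<close>; hence the gain of one order over \<open>g\<close>.
\<close>

lemma profile_C_k:
  assumes \<phi>: "\<phi> \<in> S" "T \<phi> = \<phi>" and g: "C_k K g"
  shows "k \<le> Suc K \<Longrightarrow> C_k k \<phi>"
proof (induction k)
  case 0
  then show ?case using profile_continuous[OF \<phi>] by simp
next
  case (Suc k)
  then have \<phi>k: "C_k k \<phi>" and gk: "C_k k g" using C_k_mono[OF _ g] by auto
  have shift: "C_k k (\<lambda>x. \<phi> (x + a))" for a
    by (intro C_k_compose[OF C_k_add[OF C_k_id C_k_const] \<phi>k])
  have "C_k k (\<lambda>x. (- 1 / c) * ((1 / h\<^sup>2) * ((\<phi> (x + h) + (- 2) * \<phi> x) + \<phi> (x + (- h))) + g (\<phi> x)))"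
    by (intro C_k_add C_k_mult C_k_const shift \<phi>k C_k_compose[OF \<phi>k gk])
  then have "C_k k (\<lambda>x. (- 1 / c) * ((\<phi> (x + h) - 2 * \<phi> x + \<phi> (x - h)) / h\<^sup>2 + g (\<phi> x)))"
    by simp
  then show ?case by (rule C_k_SucI[OF profile_derivative[OF \<phi>]])
qed

lemma profile_at_top:
  assumes "\<phi> \<in> S" shows "(\<phi> \<longlongrightarrow> 0) at_top"
proof (rule tendsto_sandwich[where f = "\<lambda>_. 0" and h = "\<lambda>x. exp (- \<alpha> * x)"])
  show "((\<lambda>x. exp (- \<alpha> * x)) \<longlongrightarrow> 0) at_top" using \<alpha> by real_asymp
  show "\<forall>\<^sub>F x in at_top. \<phi> x \<le> exp (- \<alpha> * x)"
    using assms by (auto simp: S_def hi_def)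
qed (use S_range[OF assms] in auto)

text \<open>
  The limit \<open>a\<close> at \<open>-\<infinity>\<close> is the supremum of the antitone profile.  The averages of \<open>H \<phi>\<close>
  have the same limit as \<open>H \<phi>\<close>, which makes \<open>a\<close> a zero of \<open>g\<close>.
\<close>

lemma profile_at_bot:
  assumes \<phi>: "\<phi> \<in> S" "T \<phi> = \<phi>" shows "(\<phi> \<longlongrightarrow> 1) at_bot"
proof -
  define a where "a = (SUP x. \<phi> x)"
  have bdd: "bdd_above (range \<phi>)" by (rule bdd_aboveI2[of _ _ 1]) (rule S_range[OF \<phi>(1)])
  have le_a: "\<phi> x \<le> a" for x unfolding a_def by (rule cSUP_upper[OF _ bdd]) simp
  have a1: "a \<le> 1" unfolding a_def by (rule cSUP_least) (use S_range[OF \<phi>(1)] in auto)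
  have lim: "(\<phi> \<longlongrightarrow> a) at_bot"
  proof (rule order_tendstoI)
    fix z assume "z < a"
    then obtain x0 where x0: "z < \<phi> x0" unfolding a_def using bdd by (auto simp: less_cSUP_iff)
    have "z < \<phi> x" if "x \<le> x0" for x
      using antimonoD[of \<phi> x x0] that \<phi>(1) x0 by (auto simp: S_def)
    then show "\<forall>\<^sub>F x in at_bot. z < \<phi> x" by (auto simp: eventually_at_bot_linorder)
  next
    fix z assume "a < z"
    then have "\<phi> x < z" for x using le_a[of x] by simp
    then show "\<forall>\<^sub>F x in at_bot. \<phi> x < z" by simp
  qed
  have a0: "a > 0"
  proof -
    \<comment> \<open>Any \<open>y\<close> with \<open>M < exp ((\<kappa> - \<alpha>) y)\<close> makes the lower barrier positive.\<close>
    define y where "y = (ln M + 1) / (\<kappa> - \<alpha>)"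
    have "M = exp (ln M)" using M by simp
    also have "\<dots> < exp ((\<kappa> - \<alpha>) * y)" using \<kappa> by (simp add: y_def)
    finally have "M * exp (- \<kappa> * y) < exp ((\<kappa> - \<alpha>) * y) * exp (- \<kappa> * y)" by simp
    also have "\<dots> = exp (- \<alpha> * y)" by (simp add: mult_exp_exp algebra_simps)
    finally have "0 < lo y" by (simp add: lo_def)
    also have "\<dots> \<le> \<phi> y" using \<phi>(1) by (auto simp: S_def)
    finally show ?thesis using le_a[of y] by simp
  qed
  have shift: "((\<lambda>x. \<phi> (x + b)) \<longlongrightarrow> a) at_bot" for b
    by (rule filterlim_compose[OF lim]) real_asymp
  have "isCont g a" using g_cont by (simp add: continuous_on_eq_continuous_at)
  then have "((\<lambda>x. g (\<phi> x)) \<longlongrightarrow> g a) at_bot" using lim by (rule isCont_tendsto_compose)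
  then have "((\<lambda>x. (\<phi> (x + h) + \<phi> (x + (- h))) / h\<^sup>2 + (g (\<phi> x) + m * \<phi> x))
      \<longlongrightarrow> (a + a) / h\<^sup>2 + (g a + m * a)) at_bot"
    using h by (intro tendsto_intros shift lim) auto
  then have "(H \<phi> \<longlongrightarrow> (a + a) / h\<^sup>2 + (g a + m * a)) at_bot"
    by (simp add: H_def[abs_def])
  also have "(a + a) / h\<^sup>2 + (g a + m * a) = \<mu> * a + g a"
    by (simp add: \<mu>_def add_divide_distrib algebra_simps)
  finally have "(exp_avg (\<mu> / c) (H \<phi>) \<longlongrightarrow> \<mu> * a + g a) at_bot"
    by (rule exp_avg_tendsto_at_bot[OF rate_pos H_measurable[OF \<phi>(1)] H_abs_le[OF \<phi>(1)]])
  then have "((\<lambda>x. exp_avg (\<mu> / c) (H \<phi>) x / \<mu>) \<longlongrightarrow> (\<mu> * a + g a) / \<mu>) at_bot"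
    using \<mu>_pos by (intro tendsto_divide tendsto_const) auto
  then have "(\<phi> \<longlongrightarrow> (\<mu> * a + g a) / \<mu>) at_bot"
    using \<phi>(2) by (simp add: T_def[abs_def])
  then have "(\<mu> * a + g a) / \<mu> = a" using lim by (rule tendsto_unique[rotated]) simp
  then have "g a = 0" using \<mu>_pos by (simp add: field_simps)
  then have "a = 1" using a0 a1 g_nz[of a] by force
  then show ?thesis using lim by simp
qed

lemma profile_solves:
  assumes \<phi>: "\<phi> \<in> S" "T \<phi> = \<phi>"
  shows "solves_lattice_rd h g (\<lambda>j t. \<phi> (of_int j * h - c * t))"
  unfolding solves_lattice_rd_def
proof (intro allI impI)
  fix t :: real and j :: int
  define x where "x = of_int j * h - c * t"
  have "((\<lambda>t. of_int j * h - c * t) has_real_derivative 0 - c * 1) (at t)"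
    by (intro DERIV_diff DERIV_const DERIV_cmult DERIV_ident)
  then have "((\<lambda>t. \<phi> (of_int j * h - c * t)) has_real_derivative
     ((- 1 / c) * ((\<phi> (x + h) - 2 * \<phi> x + \<phi> (x - h)) / h\<^sup>2 + g (\<phi> x))) * (0 - c * 1)) (at t)"
    unfolding x_def by (rule DERIV_chain2[OF profile_derivative[OF \<phi>]])
  also have "((- 1 / c) * ((\<phi> (x + h) - 2 * \<phi> x + \<phi> (x - h)) / h\<^sup>2 + g (\<phi> x))) * (0 - c * 1)
     = (\<phi> (x + h) - 2 * \<phi> x + \<phi> (x - h)) / h\<^sup>2 + g (\<phi> x)"
    using c by simp
  also have "x + h = of_int (j + 1) * h - c * t" by (simp add: x_def algebra_simps)
  also have "x - h = of_int (j - 1) * h - c * t" by (simp add: x_def algebra_simps)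
  finally show "((\<lambda>t. \<phi> (of_int j * h - c * t)) has_real_derivative
      (\<phi> (of_int (j + 1) * h - c * t) - 2 * \<phi> (of_int j * h - c * t) + \<phi> (of_int (j - 1) * h - c * t)) / h\<^sup>2 +
        g (\<phi> (of_int j * h - c * t))) (at t)"
    by (simp only: x_def)
qed

lemma profile_exists:
  obtains \<phi> where "\<phi> \<in> S" "T \<phi> = \<phi>"
  by (rule antimono_fixed_point_between[of hi lo T, folded S_def])
     (use hi_in_S T_maps T_mono in auto)

end

section \<open>Existence of the travelling waves\<close>

theorem theorem2:
  fixes K :: nat and g :: "real \<Rightarrow> real" and c :: real
  assumes "K \<ge> 2"
    and "C_k K g"
    and "consecutive_zeros g 0 1"
    and "concave_on {0..1} g"
    and "deriv g 1 < 0" and "0 < deriv g 0"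
    and "c > 2 * sqrt (deriv g 0)"
  shows "\<exists>h0>0. \<forall>h\<in>{0<..<h0}. \<exists>\<phi> :: real \<Rightarrow> real.
           C_k (K + 1) \<phi> \<and>
           (\<phi> \<longlongrightarrow> 1) at_bot \<and>
           (\<phi> \<longlongrightarrow> 0) at_top \<and>
           solves_lattice_rd h g (\<lambda>j t. \<phi> (of_int j * h - c * t))"
proof -
  define r where "r = deriv g 0"
  have r: "r > 0" using assms(6) by (simp add: r_def)
  have c: "c > 0" using assms(6,7) real_sqrt_gt_zero[of "deriv g 0"] by linarith
  have "C_k (Suc (Suc 0)) g" using C_k_mono[OF _ assms(2), of "Suc (Suc 0)"] assms(1) by simp
  note g1 = C_k_SucD[OF this]
  note g2 = C_k_SucD[OF g1(2)]
  have g_cont: "continuous_on UNIV g"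
    using C_k_mono[OF _ assms(2), of 0] by simp
  have "bounded (deriv (deriv g) ` {0..1})"
    using g2(2) by (intro compact_imp_bounded compact_continuous_image) (auto intro: continuous_on_subset)
  then obtain B where "\<forall>y\<in>deriv (deriv g) ` {0..1}. norm y \<le> B"
    unfolding bounded_iff by blast
  then have B: "\<bar>deriv (deriv g) u\<bar> \<le> B" if "u \<in> {0..1}" for u
    using that by simp
  have lip: "\<bar>deriv g u - r\<bar> \<le> B * u" if u: "0 \<le> u" "u \<le> 1" for u
  proof (cases "u = 0")
    case False
    then obtain z where "0 < z" "z < u" "deriv g u - deriv g 0 = (u - 0) * deriv (deriv g) z"
      using MVT2[of 0 u "deriv g" "deriv (deriv g)"] u g2(1) by auto
    then show ?thesis using B[of z] u by (simp add: r_def abs_mult mult.commute mult_right_mono)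
  qed (simp add: r_def)
  have B0: "B \<ge> 0" using B[of 0] by simp
  \<comment> \<open>With \<open>r = g' 0\<close> and \<open>g'\<close> Lipschitz with constant \<open>B\<close>, \<open>g'\<close> stays above \<open>- (r + B)\<close> on the unit interval.\<close>
  define m where "m = r + B"
  have m: "m > 0" using r B0 by (simp add: m_def)
  have g_mono: "g u + m * u \<le> g v + m * v" if uv: "0 \<le> u" "u \<le> v" "v \<le> 1" for u v
  proof (cases "u = v")
    case False
    then obtain z where z: "u < z" "z < v" "g v - g u = (v - u) * deriv g z"
      using MVT2[of u v g "deriv g"] uv g1(1) by auto
    have "B * z \<le> B * 1" using B0 z uv by (intro mult_left_mono) auto
    then have "- m \<le> deriv g z" using lip[of z] z uv r by (simp add: m_def abs_le_iff)
    then have "(v - u) * (- m) \<le> (v - u) * deriv g z" using uv by (intro mult_left_mono) auto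
    then show ?thesis using z(3) by (simp add: algebra_simps)
  qed simp
  have zeros: "g 0 = 0" "g 1 = 0" "\<And>u. 0 < u \<Longrightarrow> u < 1 \<Longrightarrow> g u \<noteq> 0"
    using assms(3) by (auto simp: consecutive_zeros_def)
  \<comment> \<open>Slopes of chords of a concave function from 0 decrease, so each is at most their limit \<open>g' 0\<close>.\<close>
  have g_upper: "g u \<le> r * u" if u: "0 \<le> u" "u \<le> 1" for u
  proof (rule ccontr)
    assume neg: "\<not> g u \<le> r * u"
    then have u0: "u > 0" using u zeros by (cases "u = 0") auto
    then have "g u / u > r" using neg by (simp add: field_simps)
    moreover have "((\<lambda>x. g x / x) \<longlongrightarrow> r) (at_right 0)"
    proof -
      have "((\<lambda>x. (g x - g 0) / (x - 0)) \<longlongrightarrow> r) (at_right 0)"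
        using g1(1)[of 0] unfolding r_def has_field_derivative_iff
        by (rule tendsto_within_subset) auto
      then show ?thesis by (simp add: zeros)
    qed
    ultimately have "\<forall>\<^sub>F x in at_right 0. g x / x < g u / u" by (simp add: order_tendstoD)
    moreover have "\<forall>\<^sub>F x in at_right 0. x \<in> {0<..<u}"
      using u0 by (rule eventually_at_right_real)
    ultimately have "\<forall>\<^sub>F x in at_right 0. g x / x < g u / u \<and> x \<in> {0<..<u}"
      by (rule eventually_conj)
    then obtain x where x: "g x / x < g u / u" "0 < x" "x < u"
      using eventually_happens'[OF trivial_limit_at_right_real] by fastforce
    have "g ((1 - x / u) *\<^sub>R 0 + (x / u) *\<^sub>R u) \<ge> (1 - x / u) * g 0 + (x / u) * g u"
      using x u u0 by (intro concave_onD[OF assms(4)]) auto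
    then have "g x \<ge> (x / u) * g u" using u0 zeros by simp
    then have "g x / x \<ge> g u / u" using x u0 by (simp add: field_simps)
    then show False using x by simp
  qed
  have g_lower: "r * u - B * u\<^sup>2 \<le> g u" if u: "0 \<le> u" "u \<le> 1" for u
  proof (cases "u = 0")
    case False
    then obtain z where z: "0 < z" "z < u" "g u - g 0 = (u - 0) * deriv g z"
      using MVT2[of 0 u g "deriv g"] u g1(1) by auto
    have "B * z \<le> B * u" using B0 z by (intro mult_left_mono) auto
    then have "r - B * u \<le> deriv g z" using lip[of z] z u by (simp add: abs_le_iff)
    then have "u * (r - B * u) \<le> u * deriv g z" using u by (intro mult_left_mono) auto
    then show ?thesis using z(3) zeros by (simp add: algebra_simps power2_eq_square)
  qed (simp add: zeros)
  \<comment> \<open>At \<open>a = c / 2\<close>, the minimiser of \<open>a\<^sup>2 - c a\<close>, the limiting dispersion function is below \<open>c a\<close>.\<close>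
  have "(2 * sqrt r)\<^sup>2 < c\<^sup>2"
    using assms(6,7) by (intro power_strict_mono) (auto simp: r_def)
  then have "4 * r < c\<^sup>2" using r by (simp add: power_mult_distrib)
  then have "(c / 2)\<^sup>2 + r < c * (c / 2)" by (simp add: power2_eq_square field_simps)
  then have "\<forall>\<^sub>F h in at_right 0. dispersion h r (c / 2) < c * (c / 2)"
    by (rule order_tendstoD(2)[OF dispersion_tendsto])
  then obtain h0 where h0: "h0 > 0" "\<And>h. 0 < h \<Longrightarrow> h < h0 \<Longrightarrow> dispersion h r (c / 2) < c * (c / 2)"
    unfolding eventually_at_right_field by auto
  show ?thesis
  proof (intro exI[of _ h0] conjI ballI h0(1))
    fix h assume "h \<in> {0<..<h0}"
    then have h: "h > 0" and neg: "dispersion h r (c / 2) < c * (c / 2)" using h0(2) by auto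
    obtain \<alpha> \<kappa> where \<alpha>\<kappa>: "0 < \<alpha>" "\<alpha> < \<kappa>" "\<kappa> \<le> 2 * \<alpha>"
      "dispersion h r \<alpha> = c * \<alpha>" "dispersion h r \<kappa> < c * \<kappa>"
      using dispersion_roots[OF r _ neg] c by auto
    define M where "M = max 1 (B / (c * \<kappa> - dispersion h r \<kappa>))"
    have M: "B \<le> M * (c * \<kappa> - dispersion h r \<kappa>)"
    proof -
      have "B / (c * \<kappa> - dispersion h r \<kappa>) \<le> M" by (simp add: M_def)
      then show ?thesis using \<alpha>\<kappa>(5) by (simp add: divide_le_eq)
    qed
    interpret kpp_lattice g c h m r B \<alpha> \<kappa> M
      by unfold_locales
         (use c h m r zeros g_cont g_mono g_upper g_lower B0 \<alpha>\<kappa> M in \<open>auto simp: M_def\<close>)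
    obtain \<phi> where \<phi>: "\<phi> \<in> S" "T \<phi> = \<phi>" by (rule profile_exists)
    have "C_k (K + 1) \<phi>" using profile_C_k[OF \<phi> assms(2), of "K + 1"] by simp
    then show "\<exists>\<phi>. C_k (K + 1) \<phi> \<and> (\<phi> \<longlongrightarrow> 1) at_bot \<and> (\<phi> \<longlongrightarrow> 0) at_top \<and>
        solves_lattice_rd h g (\<lambda>j t. \<phi> (of_int j * h - c * t))"
      using profile_at_bot[OF \<phi>] profile_at_top[OF \<phi>(1)] profile_solves[OF \<phi>] by blast
  qed
qed

end
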